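(* Let $k\ge1$ be an integer. The following randomized online algorithm for \textsc{MBM}: assign to each $b\in B$ a category $c(b)\in\{1,\dots,2^k\}$ independently and uniformly at random, and return $\textsc{Ranking}(\sigma_c)$, uses $k\cdot m$ random bits and has competitive ratio $1-\left(\frac{2^k}{2^k+1}\right)^{2^k}$, i.e., on every input $\mathbb{E}|M|\ge\left(1-\left(\frac{2^k}{2^k+1}\right)^{2^k}\right)|M^*|$ where $M$ is its output and $M^*$ a maximum matching.
   Context: Online maximum bipartite matching (\textsc{MBM}): the input is a bipartite graph $G=(A,B,E)$ with $A=[n]$, $B=[m]$, $m=\Theta(n)$; the $A$-vertices, together with their incident edges, arrive one at a time in an adversarially chosen order, and upon arrival of $a\in A$ the algorithm must irrevocably match $a$ to a currently unmatched neighbour or leave it unmatched. Given a category function $c:B\to\{1,\dots,2^k\}$, $\sigma_c$ is the unique permutation of $B$ with $\sigma_c(b_1)<\sigma_c(b_2)$ iff $c(b_1)<c(b_2)$, or $c(b_1)=c(b_2)$ and $b_1<b_2$. $\textsc{Ranking}(\sigma)$ matches each arriving $A$-vertex to its unmatched neighbour $b$ of minimum rank $\sigma(b)$, leaving it unmatched if none exists. *)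

theory Defs
  imports "HOL-Probability.Probability" "HOL-Combinatorics.Permutations"
begin

text \<open>Bipartite graphs on \<open>A = {1..n}\<close> and \<open>B = {1..m}\<close> are given by their edge sets
  \<open>E \<subseteq> {1..n} \<times> {1..m}\<close>; the two sides are told apart by the position in the pair.\<close>

definition is_matching :: "(nat \<times> nat) set \<Rightarrow> (nat \<times> nat) set \<Rightarrow> bool" where
  "is_matching E M \<longleftrightarrow> M \<subseteq> E \<and> inj_on fst M \<and> inj_on snd M"

definition is_maximum_matching :: "(nat \<times> nat) set \<Rightarrow> (nat \<times> nat) set \<Rightarrow> bool" where
  "is_maximum_matching E M \<longleftrightarrow>
     is_matching E M \<and> (\<forall>M'. is_matching E M' \<longrightarrow> card M' \<le> card M)"

text \<open>A deterministic online rule decides on the partner of an arriving vertex from the earlier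
  arrivals (with their neighbourhoods), the current matching, the arriving vertex and its
  neighbourhood.\<close>

type_synonym online_rule =
  "(nat \<times> nat set) list \<Rightarrow> (nat \<times> nat) set \<Rightarrow> nat \<Rightarrow> nat set \<Rightarrow> nat option"

definition legal_rule :: "online_rule \<Rightarrow> bool" where
  "legal_rule r \<longleftrightarrow> (\<forall>h M a N b. r h M a N = Some b \<longrightarrow> b \<in> N \<and> b \<notin> snd ` M)"

fun run_from ::
  "online_rule \<Rightarrow> (nat \<times> nat) set \<Rightarrow> (nat \<times> nat set) list \<Rightarrow> (nat \<times> nat) set \<Rightarrow> nat list
     \<Rightarrow> (nat \<times> nat) set" where
  "run_from r E h M [] = M"
| "run_from r E h M (a # as) =
     run_from r E (h @ [(a, E `` {a})])
       (case r h M a (E `` {a}) of None \<Rightarrow> M | Some b \<Rightarrow> insert (a, b) M) as"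

definition online_matching ::
  "online_rule \<Rightarrow> (nat \<times> nat) set \<Rightarrow> nat list \<Rightarrow> (nat \<times> nat) set" where
  "online_matching r E arrivals = run_from r E [] {} arrivals"

text \<open>Randomized computations whose only source of randomness is a sequence of fair coin flips.\<close>

datatype 'a coin = Return 'a | Flip "bool \<Rightarrow> 'a coin"

primrec bind_coin :: "'a coin \<Rightarrow> ('a \<Rightarrow> 'b coin) \<Rightarrow> 'b coin" where
  "bind_coin (Return x) g = g x"
| "bind_coin (Flip f) g = Flip (\<lambda>u. bind_coin (f u) g)"

primrec coin_pmf :: "'a coin \<Rightarrow> 'a pmf" where
  "coin_pmf (Return x) = return_pmf x"
| "coin_pmf (Flip f) = bind_pmf (bernoulli_pmf (1 / 2)) (\<lambda>u. coin_pmf (f u))"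

inductive uses_random_bits :: "'a coin \<Rightarrow> nat \<Rightarrow> bool" where
  "uses_random_bits (Return x) 0"
| "(\<And>u. uses_random_bits (f u) r) \<Longrightarrow> uses_random_bits (Flip f) (Suc r)"

text \<open>A randomized online algorithm knows \<open>B = {1..m}\<close> in advance: its argument is \<open>m\<close>, and it
  draws its random bits before the first arrival.\<close>

type_synonym randomized_online_algorithm = "nat \<Rightarrow> online_rule coin"

definition legal_algorithm :: "randomized_online_algorithm \<Rightarrow> bool" where
  "legal_algorithm alg \<longleftrightarrow> (\<forall>m. \<forall>r \<in> set_pmf (coin_pmf (alg m)). legal_rule r)"

definition has_competitive_ratio :: "randomized_online_algorithm \<Rightarrow> real \<Rightarrow> bool" where
  "has_competitive_ratio alg \<rho> \<longleftrightarrow>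
     (\<forall>n m E arrivals Mstar.
        E \<subseteq> {1..n} \<times> {1..m} \<longrightarrow>
        distinct arrivals \<longrightarrow> set arrivals = {1..n} \<longrightarrow>
        is_maximum_matching E Mstar \<longrightarrow>
        measure_pmf.expectation (coin_pmf (alg m)) (\<lambda>r. real (card (online_matching r E arrivals)))
          \<ge> \<rho> * real (card Mstar))"

definition ranking :: "(nat \<Rightarrow> nat) \<Rightarrow> online_rule" where
  "ranking \<sigma> h M a N =
     (if N - snd ` M = {} then None else Some (arg_min_on \<sigma> (N - snd ` M)))"

definition is_category_perm :: "nat \<Rightarrow> (nat \<Rightarrow> nat) \<Rightarrow> (nat \<Rightarrow> nat) \<Rightarrow> bool" where
  "is_category_perm m c \<sigma> \<longleftrightarrow>
     \<sigma> permutes {1..m} \<and>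
     (\<forall>b1 \<in> {1..m}. \<forall>b2 \<in> {1..m}.
        \<sigma> b1 < \<sigma> b2 \<longleftrightarrow> c b1 < c b2 \<or> (c b1 = c b2 \<and> b1 < b2))"

definition category_perm :: "nat \<Rightarrow> (nat \<Rightarrow> nat) \<Rightarrow> nat \<Rightarrow> nat" where
  "category_perm m c = (THE \<sigma>. is_category_perm m c \<sigma>)"

lemma is_category_perm_ex1: "\<exists>!\<sigma>. is_category_perm m c \<sigma>"
proof -
  define B where "B = {1..m}"
  define lt where "lt x y \<longleftrightarrow> c x < c y \<or> (c x = c y \<and> x < y)" for x y :: nat
  define \<tau> where "\<tau> b = (if b \<in> B then card {x \<in> B. \<not> lt b x} else b)" for b
  have fin: "finite B" by (simp add: B_def)
  have mono: "\<tau> x < \<tau> y" if "x \<in> B" "y \<in> B" "lt x y" for x y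
  proof -
    have "{z \<in> B. \<not> lt x z} \<subseteq> {z \<in> B. \<not> lt y z}" "y \<in> {z \<in> B. \<not> lt y z}"
      "y \<notin> {z \<in> B. \<not> lt x z}"
      using that by (auto simp: lt_def)
    then have "{z \<in> B. \<not> lt x z} \<subset> {z \<in> B. \<not> lt y z}" by blast
    then show ?thesis using that fin by (simp add: \<tau>_def psubset_card_mono)
  qed
  have total: "lt x y \<or> x = y \<or> lt y x" for x y by (auto simp: lt_def)
  have iff: "\<tau> x < \<tau> y \<longleftrightarrow> lt x y" if "x \<in> B" "y \<in> B" for x y
    using mono[of x y] mono[of y x] total[of x y] that by (metis less_asym less_irrefl)
  have inj: "inj_on \<tau> B"
    by (rule inj_onI) (use mono total in \<open>metis less_irrefl\<close>)
  have sub: "\<tau> ` B \<subseteq> B"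
  proof
    fix y assume "y \<in> \<tau> ` B"
    then obtain b where b: "b \<in> B" "y = card {x \<in> B. \<not> lt b x}" by (auto simp: \<tau>_def)
    have "b \<in> {x \<in> B. \<not> lt b x}" using b by (simp add: lt_def)
    then have "y > 0" unfolding b(2) card_gt_0_iff using fin by auto
    moreover have "y \<le> card B" using b fin by (auto intro: card_mono)
    ultimately show "y \<in> B" by (simp add: B_def)
  qed
  have "bij_betw \<tau> B B" using endo_inj_surj[OF fin sub inj] inj by (simp add: bij_betw_def)
  then have "\<tau> permutes B" by (rule bij_imp_permutes) (simp add: \<tau>_def)
  then have ex: "is_category_perm m c \<tau>"
    using iff by (simp add: is_category_perm_def B_def lt_def)
  have "\<sigma> b = \<tau> b" if \<sigma>: "is_category_perm m c \<sigma>" for \<sigma> b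
  proof (cases "b \<in> B")
    case True
    have p: "\<sigma> permutes B" and i: "\<And>x y. x \<in> B \<Longrightarrow> y \<in> B \<Longrightarrow> \<sigma> x < \<sigma> y \<longleftrightarrow> lt x y"
      using \<sigma> by (simp_all add: is_category_perm_def B_def lt_def)
    have sb: "\<sigma> b \<in> B" using permutes_in_image[OF p] True by simp
    have "\<sigma> ` {x \<in> B. \<not> lt b x} = {1..\<sigma> b}"
    proof
      show "\<sigma> ` {x \<in> B. \<not> lt b x} \<subseteq> {1..\<sigma> b}"
        using i[OF True] permutes_in_image[OF p] by (fastforce simp: B_def)
      show "{1..\<sigma> b} \<subseteq> \<sigma> ` {x \<in> B. \<not> lt b x}"
      proof
        fix y assume y: "y \<in> {1..\<sigma> b}"
        then have "y \<in> B" using sb by (simp add: B_def)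
        then obtain x where "x \<in> B" "y = \<sigma> x" using permutes_image[OF p] by blast
        then show "y \<in> \<sigma> ` {x \<in> B. \<not> lt b x}" using y i[OF True] by force
      qed
    qed
    moreover have "inj_on \<sigma> {x \<in> B. \<not> lt b x}" using permutes_inj_on[OF p] .
    ultimately have "card {1..\<sigma> b} = card {x \<in> B. \<not> lt b x}" using card_image by metis
    then show ?thesis using True by (simp add: \<tau>_def)
  next
    case False
    have "\<sigma> permutes B" using \<sigma> by (simp add: is_category_perm_def B_def)
    then show ?thesis using False permutes_not_in[of \<sigma> B b] by (simp add: \<tau>_def)
  qed
  then have "\<sigma> = \<tau>" if "is_category_perm m c \<sigma>" for \<sigma> using that by blast
  with ex show ?thesis by blast
qed

text \<open>A category in \<open>{1..2 ^ k}\<close> is drawn by reading \<open>k\<close> bits as a binary number and adding 1.\<close>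

primrec draw_bits :: "nat \<Rightarrow> bool list coin" where
  "draw_bits 0 = Return []"
| "draw_bits (Suc k) = Flip (\<lambda>u. map_coin (\<lambda>us. u # us) (draw_bits k))"

definition draw_category :: "nat \<Rightarrow> nat coin" where
  "draw_category k = map_coin (\<lambda>us. 1 + horner_sum of_bool 2 us) (draw_bits k)"

primrec draw_categories :: "nat \<Rightarrow> nat list \<Rightarrow> (nat \<Rightarrow> nat) coin" where
  "draw_categories k [] = Return (\<lambda>_. 0)"
| "draw_categories k (b # bs) =
     bind_coin (draw_category k) (\<lambda>x. map_coin (\<lambda>c. c(b := x)) (draw_categories k bs))"

definition random_categories :: "nat \<Rightarrow> nat \<Rightarrow> (nat \<Rightarrow> nat) coin" where
  "random_categories k m = draw_categories k [1..<Suc m]"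

definition category_ranking :: "nat \<Rightarrow> randomized_online_algorithm" where
  "category_ranking k m = map_coin (\<lambda>c. ranking (category_perm m c)) (random_categories k m)"

end

theory Submission
  imports Defs
begin

text \<open>
  Write \<open>K = 2 ^ k\<close> and split the unit gained by matching \<open>a\<close> to a vertex of category \<open>t\<close> into
  \<open>g t\<close> for the \<open>B\<close>-vertex and \<open>1 - g t\<close> for \<open>a\<close>, where
  \<open>g t = (K / (K + 1)) ^ (K + 1 - t)\<close> (\<open>share K t\<close>). It suffices that every edge \<open>(a, b)\<close>
  of a maximum matching receives \<open>1 - g 1\<close> in expectation from its two endpoints.
  Fix the categories of all vertices other than \<open>b\<close>, and let \<open>y\<close> be the category of the partner
  of \<open>a\<close> in the run on the graph without \<open>b\<close> (\<open>K + 1\<close> if \<open>a\<close> stays unmatched). Putting \<open>b\<close> back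
  never worsens the partner of \<open>a\<close>, so \<open>a\<close> keeps at least \<open>1 - g y\<close>; and \<open>b\<close> is matched whenever
  its category is below \<open>y\<close>. The function \<open>g\<close> solves
  \<open>1 - g y + (g 1 + \<dots> + g (y - 1)) / K = 1 - g 1\<close> for all \<open>y\<close> in \<open>{1..K + 1}\<close>,
  with \<open>g (K + 1) = 1\<close>.
\<close>

section \<open>Coin-flip computations\<close>

lemma coin_pmf_map_coin: "coin_pmf (map_coin f x) = map_pmf f (coin_pmf x)"
  by (induction x) (simp_all add: map_bind_pmf)

lemma coin_pmf_bind_coin: "coin_pmf (bind_coin x g) = bind_pmf (coin_pmf x) (\<lambda>v. coin_pmf (g v))"
  by (induction x) (simp_all add: bind_return_pmf bind_assoc_pmf)

lemma uses_random_bits_map_coin: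
  "uses_random_bits x r \<Longrightarrow> uses_random_bits (map_coin f x) r"
  by (induction rule: uses_random_bits.induct) (auto intro: uses_random_bits.intros)

lemma uses_random_bits_bind_coin:
  "uses_random_bits x r \<Longrightarrow> (\<And>v. uses_random_bits (g v) s) \<Longrightarrow>
    uses_random_bits (bind_coin x g) (r + s)"
  by (induction rule: uses_random_bits.induct) (auto intro: uses_random_bits.intros)

lemma uses_random_bits_draw_bits: "uses_random_bits (draw_bits k) k"
  by (induction k) (auto intro: uses_random_bits.intros uses_random_bits_map_coin)

lemma uses_random_bits_draw_category: "uses_random_bits (draw_category k) k"
  unfolding draw_category_def by (intro uses_random_bits_map_coin uses_random_bits_draw_bits)

lemma uses_random_bits_draw_categories:
  "uses_random_bits (draw_categories k bs) (k * length bs)"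
  by (induction bs)
    (auto intro!: uses_random_bits.intros uses_random_bits_bind_coin
      uses_random_bits_map_coin uses_random_bits_draw_category)

lemma uses_random_bits_category_ranking: "uses_random_bits (category_ranking k m) (k * m)"
  using uses_random_bits_draw_categories[of k "[1..<Suc m]"]
  by (simp add: category_ranking_def random_categories_def uses_random_bits_map_coin del: upt_Suc)

lemma pair_pmf_of_set:
  assumes "finite A" "A \<noteq> {}" "finite B" "B \<noteq> {}"
  shows "pair_pmf (pmf_of_set A) (pmf_of_set B) = pmf_of_set (A \<times> B)"
proof (rule pmf_eqI)
  fix x :: "'a \<times> 'b"
  show "pmf (pair_pmf (pmf_of_set A) (pmf_of_set B)) x = pmf (pmf_of_set (A \<times> B)) x"
    using assms by (cases x) (simp add: pmf_pair indicator_times card_cartesian_product)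
qed

lemma map_horner_sum_draw_bits:
  "map_pmf (horner_sum of_bool 2) (coin_pmf (draw_bits k)) = pmf_of_set {..<2 ^ k :: nat}"
proof (induction k)
  case 0
  have "{..<Suc 0} = {0}" by auto
  then show ?case by (simp add: pmf_of_set_singleton)
next
  case (Suc k)
  let ?f = "\<lambda>(u, x). of_bool u + 2 * x :: nat"
  have "map_pmf (horner_sum of_bool 2) (coin_pmf (draw_bits (Suc k))) =
      bind_pmf (bernoulli_pmf (1 / 2)) (\<lambda>u. map_pmf (\<lambda>x. of_bool u + 2 * x)
        (map_pmf (horner_sum of_bool 2) (coin_pmf (draw_bits k))))"
    by (simp add: map_bind_pmf coin_pmf_map_coin pmf.map_comp o_def)
  also have "\<dots> = map_pmf ?f (pair_pmf (pmf_of_set UNIV) (pmf_of_set {..<2 ^ k}))"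
    unfolding Suc bernoulli_pmf_half_conv_pmf_of_set
    by (simp add: pair_pmf_def map_bind_pmf map_pmf_def bind_assoc_pmf bind_return_pmf)
  also have "\<dots> = map_pmf ?f (pmf_of_set (UNIV \<times> {..<2 ^ k}))"
    by (simp add: pair_pmf_of_set lessThan_empty_iff)
  also have "\<dots> = pmf_of_set {..<2 ^ Suc k}"
  proof (rule map_pmf_of_set_bij_betw)
    show "bij_betw ?f (UNIV \<times> {..<2 ^ k}) {..<2 ^ Suc k}"
      by (rule bij_betwI[where g = "\<lambda>x. (odd x, x div 2)"]) (auto split: if_splits)
  qed (auto simp: lessThan_empty_iff)
  finally show ?case .
qed

lemma coin_pmf_draw_category: "coin_pmf (draw_category k) = pmf_of_set {1..2 ^ k}"
proof -
  have "coin_pmf (draw_category k) =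
      map_pmf (\<lambda>x. 1 + x) (map_pmf (horner_sum of_bool 2) (coin_pmf (draw_bits k)))"
    by (simp add: draw_category_def coin_pmf_map_coin pmf.map_comp o_def)
  also have "\<dots> = pmf_of_set {1..2 ^ k}"
    unfolding map_horner_sum_draw_bits
  proof (rule map_pmf_of_set_bij_betw)
    show "bij_betw (\<lambda>x. 1 + x) {..<2 ^ k :: nat} {1..2 ^ k}"
      by (rule bij_betwI[where g = "\<lambda>x. x - 1"]) auto
  qed (auto simp: lessThan_empty_iff)
  finally show ?thesis .
qed

lemma coin_pmf_draw_categories:
  "distinct bs \<Longrightarrow>
    coin_pmf (draw_categories k bs) = Pi_pmf (set bs) 0 (\<lambda>_. pmf_of_set {1..2 ^ k})"
proof (induction bs)
  case (Cons b bs)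
  then show ?case
    by (simp add: coin_pmf_bind_coin coin_pmf_map_coin coin_pmf_draw_category Pi_pmf_insert'
        map_pmf_def)
qed simp

lemma coin_pmf_random_categories:
  "coin_pmf (random_categories k m) = Pi_pmf {1..m} 0 (\<lambda>_. pmf_of_set {1..2 ^ k})"
proof -
  have "set [1..<Suc m] = {1..m}" by auto
  then show ?thesis
    using coin_pmf_draw_categories[of "[1..<Suc m]" k]
    by (simp add: random_categories_def del: upt_Suc)
qed

lemma coin_pmf_category_ranking:
  "coin_pmf (category_ranking k m) =
    map_pmf (\<lambda>c. ranking (category_perm m c)) (Pi_pmf {1..m} 0 (\<lambda>_. pmf_of_set {1..2 ^ k}))"
  by (simp add: category_ranking_def coin_pmf_map_coin coin_pmf_random_categories)


section \<open>Runs of Ranking\<close>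

lemma is_matching_insert:
  assumes "is_matching E M" "(a, b) \<in> E" "a \<notin> fst ` M" "b \<notin> snd ` M"
  shows "is_matching E (insert (a, b) M)"
  using assms by (auto simp: is_matching_def inj_on_def image_iff)

lemma is_matching_run_from:
  assumes "legal_rule r"
  shows "is_matching E M \<Longrightarrow> distinct as \<Longrightarrow> fst ` M \<inter> set as = {} \<Longrightarrow>
    is_matching E (run_from r E h M as)"
proof (induction as arbitrary: h M)
  case (Cons a as)
  show ?case
  proof (cases "r h M a (E `` {a})")
    case None
    then show ?thesis using Cons by simp
  next
    case (Some b)
    then have "b \<in> E `` {a}" "b \<notin> snd ` M"
      using assms unfolding legal_rule_def by blast+
    then have "is_matching E (insert (a, b) M)"
      using Cons.prems by (intro is_matching_insert) auto
    then show ?thesis using Cons Some by simp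
  qed
qed simp

lemma is_matching_online_matching:
  "legal_rule r \<Longrightarrow> distinct as \<Longrightarrow> is_matching E (online_matching r E as)"
  unfolding online_matching_def by (rule is_matching_run_from) (auto simp: is_matching_def)

lemma arg_min_on_nat_in: "S \<noteq> {} \<Longrightarrow> arg_min_on (f :: 'a \<Rightarrow> nat) S \<in> S"
  unfolding arg_min_on_def using arg_min_natI[of "\<lambda>x. x \<in> S"] by blast

lemma arg_min_on_nat_le: "x \<in> S \<Longrightarrow> f (arg_min_on f S) \<le> (f x :: nat)"
  unfolding arg_min_on_def by (rule arg_min_nat_le)

lemma arg_min_on_order_cong:
  assumes "\<And>x y. x \<in> S \<Longrightarrow> y \<in> S \<Longrightarrow> f x < f y \<longleftrightarrow> g x < g y"
  shows "arg_min_on f S = arg_min_on g S"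
proof -
  have "is_arg_min f (\<lambda>x. x \<in> S) = is_arg_min g (\<lambda>x. x \<in> S)"
    unfolding is_arg_min_def using assms by blast
  then show ?thesis by (simp add: arg_min_on_def arg_min_def)
qed

lemma arg_min_on_nat_subset_eq:
  fixes f :: "'a \<Rightarrow> nat"
  assumes "inj_on f S" "T \<subseteq> S" "arg_min_on f S \<in> T"
  shows "arg_min_on f T = arg_min_on f S"
  unfolding arg_min_on_def[of f T]
proof (rule arg_min_inj_eq)
  show "inj_on f {x. x \<in> T}" using assms(1,2) by (simp add: inj_on_subset)
  show "\<forall>x. x \<in> T \<longrightarrow> f (arg_min_on f S) \<le> f x"
    using assms(2) by (auto intro: arg_min_on_nat_le)
qed fact

lemma legal_rule_ranking: "legal_rule (ranking \<sigma>)"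
  unfolding legal_rule_def ranking_def using arg_min_on_nat_in
  by (metis DiffD1 DiffD2 option.distinct(1) option.sel)

definition rank_step ::
  "(nat \<Rightarrow> nat) \<Rightarrow> (nat \<times> nat) set \<Rightarrow> (nat \<times> nat) set \<Rightarrow> nat \<Rightarrow> (nat \<times> nat) set" where
  "rank_step \<sigma> E M a =
     (let F = E `` {a} - snd ` M in if F = {} then M else insert (a, arg_min_on \<sigma> F) M)"

lemma run_from_ranking: "run_from (ranking \<sigma>) E h M as = foldl (rank_step \<sigma> E) M as"
  by (induction as arbitrary: h M) (simp_all add: ranking_def rank_step_def Let_def)

lemma online_matching_ranking: "online_matching (ranking \<sigma>) E as = foldl (rank_step \<sigma> E) {} as"
  by (simp add: online_matching_def run_from_ranking)

lemma rank_step_mono: "M \<subseteq> rank_step \<sigma> E M a"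
  by (auto simp: rank_step_def Let_def)

lemma foldl_rank_step_mono: "M \<subseteq> foldl (rank_step \<sigma> E) M as"
  by (induction as arbitrary: M) (use rank_step_mono in fastforce)+

lemma online_ranking_order_cong:
  assumes "\<And>x y. x \<in> snd ` E \<Longrightarrow> y \<in> snd ` E \<Longrightarrow> \<sigma> x < \<sigma> y \<longleftrightarrow> \<tau> x < \<tau> y"
  shows "online_matching (ranking \<sigma>) E as = online_matching (ranking \<tau>) E as"
proof -
  have "arg_min_on \<sigma> (E `` {a} - snd ` M) = arg_min_on \<tau> (E `` {a} - snd ` M)"
    for M :: "(nat \<times> nat) set" and a
  proof (rule arg_min_on_order_cong)
    fix x y assume "x \<in> E `` {a} - snd ` M" "y \<in> E `` {a} - snd ` M"
    then show "\<sigma> x < \<sigma> y \<longleftrightarrow> \<tau> x < \<tau> y" by (intro assms) force+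
  qed
  then have "rank_step \<sigma> E = rank_step \<tau> E" by (intro ext) (simp add: rank_step_def)
  then show ?thesis by (simp add: online_matching_ranking)
qed

lemma rank_step_subgraph:
  assumes "inj \<sigma>" "E' \<subseteq> E" "rank_step \<sigma> E M a \<subseteq> M \<union> E'"
  shows "rank_step \<sigma> E' M a = rank_step \<sigma> E M a"
proof -
  let ?F = "E `` {a} - snd ` M" and ?F' = "E' `` {a} - snd ` M"
  have sub: "?F' \<subseteq> ?F" using assms(2) by blast
  show ?thesis
  proof (cases "?F = {}")
    case True
    then have "?F' = {}" using sub by blast
    with True show ?thesis by (simp only: rank_step_def Let_def if_True)
  next
    case False
    let ?v = "arg_min_on \<sigma> ?F"
    have "?v \<in> ?F" using False by (rule arg_min_on_nat_in)
    moreover from this have "(a, ?v) \<in> E'"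
      using assms(3) False by (force simp: rank_step_def Let_def)
    ultimately have v: "?v \<in> ?F'" by blast
    have "inj_on \<sigma> ?F" using assms(1) by (rule inj_on_subset) simp
    then have "arg_min_on \<sigma> ?F' = ?v" using sub v by (rule arg_min_on_nat_subset_eq)
    then show ?thesis using False v unfolding rank_step_def Let_def by auto
  qed
qed

lemma foldl_rank_step_subgraph:
  assumes "inj \<sigma>" "E' \<subseteq> E" "foldl (rank_step \<sigma> E) M as \<subseteq> M \<union> E'"
  shows "foldl (rank_step \<sigma> E') M as = foldl (rank_step \<sigma> E) M as"
  using assms(3)
proof (induction as arbitrary: M)
  case (Cons a as)
  let ?N = "rank_step \<sigma> E M a"
  have "?N \<subseteq> M \<union> E'" using Cons.prems foldl_rank_step_mono[of ?N] by force
  then have "rank_step \<sigma> E' M a = ?N" using assms(1,2) by (intro rank_step_subgraph)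
  then show ?case using Cons rank_step_mono[of M \<sigma> E a] by auto
qed simp

lemma online_ranking_subgraph:
  assumes "inj \<sigma>" "E' \<subseteq> E" "online_matching (ranking \<sigma>) E as \<subseteq> E'"
  shows "online_matching (ranking \<sigma>) E' as = online_matching (ranking \<sigma>) E as"
  using foldl_rank_step_subgraph[of \<sigma> E' E "{}"] assms by (simp add: online_matching_ranking)

definition delete_right :: "nat set \<Rightarrow> (nat \<times> nat) set \<Rightarrow> (nat \<times> nat) set" where
  "delete_right D E = {e \<in> E. snd e \<notin> D}"

text \<open>Compares a run \<open>M\<close> on the whole graph with a run \<open>M'\<close> on the graph without \<open>D\<close>. The first
  conjunct, by which every vertex outside \<open>D\<close> that is free in \<open>M'\<close> is also free in \<open>M\<close>, makes
  the second one inductive.\<close>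

definition dominates ::
  "(nat \<Rightarrow> nat) \<Rightarrow> nat set \<Rightarrow> (nat \<times> nat) set \<Rightarrow> (nat \<times> nat) set \<Rightarrow> bool" where
  "dominates \<sigma> D M M' \<longleftrightarrow>
     snd ` M \<subseteq> D \<union> snd ` M' \<and> (\<forall>a u'. (a, u') \<in> M' \<longrightarrow> (\<exists>u. (a, u) \<in> M \<and> \<sigma> u \<le> \<sigma> u'))"

lemma dominates_insert_left:
  assumes "dominates \<sigma> D M M'" "v \<in> D \<union> snd ` M'"
  shows "dominates \<sigma> D (insert (a, v) M) M'"
  using assms unfolding dominates_def image_insert snd_conv by blast

lemma dominates_insert:
  assumes "dominates \<sigma> D M M'" "v \<in> D \<union> insert v' (snd ` M')" "\<sigma> v \<le> \<sigma> v'"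
  shows "dominates \<sigma> D (insert (a, v) M) (insert (a, v') M')"
proof -
  have "snd ` insert (a, v) M \<subseteq> D \<union> snd ` insert (a, v') M'"
    using assms(1,2) by (auto simp: dominates_def)
  moreover have "\<exists>w. (x, w) \<in> insert (a, v) M \<and> \<sigma> w \<le> \<sigma> w'"
    if "(x, w') \<in> insert (a, v') M'" for x w'
    using assms(1,3) that unfolding dominates_def by blast
  ultimately show ?thesis by (simp add: dominates_def)
qed

lemma dominates_rank_step:
  assumes "inj \<sigma>" "dominates \<sigma> D M M'"
  shows "dominates \<sigma> D (rank_step \<sigma> E M a) (rank_step \<sigma> (delete_right D E) M' a)"
proof -
  let ?F = "E `` {a} - snd ` M" and ?F' = "delete_right D E `` {a} - snd ` M'"
  let ?v = "arg_min_on \<sigma> ?F" and ?v' = "arg_min_on \<sigma> ?F'"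
  have sub: "?F' \<subseteq> ?F" using assms(2) by (auto simp: dominates_def delete_right_def)
  have diff: "?F - ?F' \<subseteq> D \<union> snd ` M'" by (auto simp: delete_right_def)
  have step: "rank_step \<sigma> E M a = (if ?F = {} then M else insert (a, ?v) M)"
    "rank_step \<sigma> (delete_right D E) M' a = (if ?F' = {} then M' else insert (a, ?v') M')"
    by (simp_all add: rank_step_def Let_def)
  consider (none_free) "?F = {}" "?F' = {}" | (only_deleted_free) "?F \<noteq> {}" "?F' = {}"
    | (both_free) "?F \<noteq> {}" "?F' \<noteq> {}"
    using sub by blast
  then show ?thesis
  proof cases
    case none_free
    then show ?thesis unfolding step using assms(2) by simp
  next
    case only_deleted_free
    then have "?v \<in> D \<union> snd ` M'" using arg_min_on_nat_in[of ?F \<sigma>] diff by blast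
    then have "dominates \<sigma> D (insert (a, ?v) M) M'" using assms(2) by (intro dominates_insert_left)
    then show ?thesis unfolding step using only_deleted_free by simp
  next
    case both_free
    have v: "?v \<in> ?F" using both_free(1) by (rule arg_min_on_nat_in)
    have v': "?v' \<in> ?F'" using both_free(2) by (rule arg_min_on_nat_in)
    have "?v \<in> D \<union> insert ?v' (snd ` M')"
    proof (cases "?v \<in> ?F'")
      case True
      have "inj_on \<sigma> ?F" using assms(1) by (rule inj_on_subset) simp
      from this sub True have "?v' = ?v" by (rule arg_min_on_nat_subset_eq)
      then show ?thesis by simp
    next
      case False
      then show ?thesis using v diff by blast
    qed
    moreover have "\<sigma> ?v \<le> \<sigma> ?v'" using v' sub by (intro arg_min_on_nat_le) blast
    ultimately have "dominates \<sigma> D (insert (a, ?v) M) (insert (a, ?v') M')"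
      using assms(2) by (intro dominates_insert)
    then show ?thesis unfolding step using both_free by simp
  qed
qed

lemma dominates_foldl_rank_step:
  assumes "inj \<sigma>"
  shows "dominates \<sigma> D M M' \<Longrightarrow>
    dominates \<sigma> D (foldl (rank_step \<sigma> E) M as) (foldl (rank_step \<sigma> (delete_right D E)) M' as)"
  by (induction as arbitrary: M M') (simp_all add: dominates_rank_step[OF assms])

lemma dominates_online_ranking:
  assumes "inj \<sigma>"
  shows "dominates \<sigma> D (online_matching (ranking \<sigma>) E as)
    (online_matching (ranking \<sigma>) (delete_right D E) as)"
  unfolding online_matching_ranking
  by (rule dominates_foldl_rank_step[OF assms]) (simp add: dominates_def)

lemma online_ranking_partner_if_unmatched:
  assumes "inj \<sigma>" "a \<in> set as" "(a, b) \<in> E" "b \<notin> snd ` online_matching (ranking \<sigma>) E as"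
  obtains u where "(a, u) \<in> online_matching (ranking \<sigma>) E as" "\<sigma> u < \<sigma> b"
proof -
  obtain xs ys where as: "as = xs @ a # ys" using assms(2) by (meson split_list)
  let ?M = "foldl (rank_step \<sigma> E) {} xs"
  let ?F = "E `` {a} - snd ` ?M"
  let ?v = "arg_min_on \<sigma> ?F"
  have sub: "rank_step \<sigma> E ?M a \<subseteq> online_matching (ranking \<sigma>) E as"
    unfolding online_matching_ranking as using foldl_rank_step_mono by simp
  then have "b \<notin> snd ` ?M" using rank_step_mono[of ?M \<sigma> E a] assms(4) by blast
  then have b: "b \<in> ?F" using assms(3) by blast
  then have "(a, ?v) \<in> rank_step \<sigma> E ?M a" by (auto simp: rank_step_def Let_def)
  then have mem: "(a, ?v) \<in> online_matching (ranking \<sigma>) E as" using sub by blast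
  then have "?v \<noteq> b" using assms(4) by force
  moreover have "\<sigma> ?v \<le> \<sigma> b" using b by (rule arg_min_on_nat_le)
  ultimately have "\<sigma> ?v < \<sigma> b" using assms(1) by (metis inj_eq le_neq_implies_less)
  with mem show ?thesis by (rule that)
qed


section \<open>Categories of partners\<close>

lemma is_category_perm_category_perm: "is_category_perm m c (category_perm m c)"
  unfolding category_perm_def using is_category_perm_ex1 by (rule theI')

lemma inj_category_perm: "inj (category_perm m c)"
  using is_category_perm_category_perm permutes_inj unfolding is_category_perm_def by blast

lemma category_perm_less_iff:
  "x \<in> {1..m} \<Longrightarrow> y \<in> {1..m} \<Longrightarrow>
    category_perm m c x < category_perm m c y \<longleftrightarrow> c x < c y \<or> c x = c y \<and> x < y"
  using is_category_perm_category_perm[of m c] unfolding is_category_perm_def by blast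

lemma category_le_if_category_perm_le:
  "x \<in> {1..m} \<Longrightarrow> y \<in> {1..m} \<Longrightarrow> category_perm m c x \<le> category_perm m c y \<Longrightarrow> c x \<le> c y"
  using category_perm_less_iff[of y m x c] by force

definition category_matching ::
  "nat \<Rightarrow> (nat \<Rightarrow> nat) \<Rightarrow> (nat \<times> nat) set \<Rightarrow> nat list \<Rightarrow> (nat \<times> nat) set" where
  "category_matching m c = online_matching (ranking (category_perm m c))"

lemma is_matching_category_matching:
  "distinct as \<Longrightarrow> is_matching E (category_matching m c E as)"
  by (simp add: category_matching_def is_matching_online_matching legal_rule_ranking)

lemma category_matching_cong:
  assumes "snd ` E \<subseteq> {1..m}" "\<And>u. u \<in> snd ` E \<Longrightarrow> c u = d u"
  shows "category_matching m c E as = category_matching m d E as"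
  unfolding category_matching_def
proof (rule online_ranking_order_cong)
  fix x y assume xy: "x \<in> snd ` E" "y \<in> snd ` E"
  then have "x \<in> {1..m}" "y \<in> {1..m}" using assms(1) by blast+
  then show "category_perm m c x < category_perm m c y \<longleftrightarrow> category_perm m d x < category_perm m d y"
    using assms(2) xy by (simp add: category_perm_less_iff)
qed

text \<open>An unmatched vertex counts as having a partner of category \<open>K + 1\<close>, one worse than all
  actual categories.\<close>

definition partner_category :: "nat \<Rightarrow> (nat \<Rightarrow> nat) \<Rightarrow> (nat \<times> nat) set \<Rightarrow> nat \<Rightarrow> nat" where
  "partner_category K c M a = (if a \<in> fst ` M then c (THE u. (a, u) \<in> M) else K + 1)"

lemma partner_category_unmatched: "a \<notin> fst ` M \<Longrightarrow> partner_category K c M a = K + 1"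
  by (simp add: partner_category_def)

lemma partner_category_matched:
  assumes "inj_on fst M" "(a, u) \<in> M"
  shows "partner_category K c M a = c u"
proof -
  have "(THE u. (a, u) \<in> M) = u"
    using assms(2) inj_onD[OF assms(1), of "(a, u)"] by (intro the_equality) fastforce+
  then show ?thesis using assms(2) by (force simp: partner_category_def)
qed

lemma partner_category_cong:
  assumes "inj_on fst M" "\<And>u. u \<in> snd ` M \<Longrightarrow> c u = d u"
  shows "partner_category K c M a = partner_category K d M a"
proof (cases "a \<in> fst ` M")
  case True
  then obtain u where "(a, u) \<in> M" by force
  then show ?thesis using assms by (force simp: partner_category_matched)
qed (simp add: partner_category_unmatched)

lemma partner_category_bounds:
  assumes "inj_on fst M" "\<And>u. u \<in> snd ` M \<Longrightarrow> c u \<in> {1..K}"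
  shows "partner_category K c M a \<in> {1..K + 1}"
proof (cases "a \<in> fst ` M")
  case True
  then obtain u where "(a, u) \<in> M" by force
  then show ?thesis using assms(1) assms(2)[of u] by (force simp: partner_category_matched)
qed (simp add: partner_category_unmatched)

lemma partner_category_delete_right_upd:
  assumes "snd ` E \<subseteq> {1..m}" "distinct as"
  shows "partner_category K (c(b := x)) (category_matching m (c(b := x)) (delete_right {b} E) as) a
    = partner_category K c (category_matching m c (delete_right {b} E) as) a"
proof -
  let ?M = "category_matching m c (delete_right {b} E) as"
  have "is_matching (delete_right {b} E) ?M"
    using assms(2) by (rule is_matching_category_matching)
  then have "inj_on fst ?M" "b \<notin> snd ` ?M" by (auto simp: is_matching_def delete_right_def)
  then have "partner_category K (c(b := x)) ?M a = partner_category K c ?M a"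
    by (intro partner_category_cong) auto
  moreover have "category_matching m (c(b := x)) (delete_right {b} E) as = ?M"
    using assms(1) by (intro category_matching_cong) (auto simp: delete_right_def)
  ultimately show ?thesis by simp
qed

lemma partner_category_le_delete_right:
  assumes E: "snd ` E \<subseteq> {1..m}" and "distinct as" and c: "\<And>u. u \<in> snd ` E \<Longrightarrow> c u \<in> {1..K}"
  shows "partner_category K c (category_matching m c E as) a
    \<le> partner_category K c (category_matching m c (delete_right D E) as) a"
proof -
  let ?M = "category_matching m c E as" and ?M' = "category_matching m c (delete_right D E) as"
  let ?\<sigma> = "category_perm m c"
  have M: "is_matching E ?M" and M': "is_matching (delete_right D E) ?M'"
    using \<open>distinct as\<close> by (rule is_matching_category_matching)+
  show ?thesis
  proof (cases "a \<in> fst ` ?M'")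
    case True
    then obtain u' where u': "(a, u') \<in> ?M'" by force
    have "dominates ?\<sigma> D ?M ?M'"
      unfolding category_matching_def by (rule dominates_online_ranking[OF inj_category_perm])
    then obtain u where u: "(a, u) \<in> ?M" "?\<sigma> u \<le> ?\<sigma> u'"
      using u' unfolding dominates_def by blast
    have "(a, u) \<in> E" "(a, u') \<in> E"
      using u(1) u' M M' by (auto simp: is_matching_def delete_right_def)
    then have "u \<in> {1..m}" "u' \<in> {1..m}" using E by force+
    then have "c u \<le> c u'" using u(2) by (rule category_le_if_category_perm_le)
    then show ?thesis using u(1) u' M M' by (simp add: is_matching_def partner_category_matched)
  next
    case False
    have "partner_category K c ?M a \<in> {1..K + 1}"
      using M c by (intro partner_category_bounds) (auto simp: is_matching_def)
    then show ?thesis using False by (simp add: partner_category_unmatched)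
  qed
qed

lemma category_matching_matches_if_less:
  assumes E: "snd ` E \<subseteq> {1..m}" and "distinct as" and a: "a \<in> set as" and ab: "(a, b) \<in> E"
    and less: "c b < partner_category K c (category_matching m c (delete_right {b} E) as) a"
  shows "b \<in> snd ` category_matching m c E as"
proof (rule ccontr)
  let ?M = "category_matching m c E as" and ?\<sigma> = "category_perm m c"
  assume unmatched: "b \<notin> snd ` ?M"
  have M: "is_matching E ?M" using \<open>distinct as\<close> by (rule is_matching_category_matching)
  have "?M \<subseteq> delete_right {b} E"
    using M unmatched by (auto simp: is_matching_def delete_right_def)
  then have eq: "category_matching m c (delete_right {b} E) as = ?M"
    unfolding category_matching_def
    by (intro online_ranking_subgraph inj_category_perm) (auto simp: delete_right_def)
  obtain u where u: "(a, u) \<in> ?M" "?\<sigma> u < ?\<sigma> b"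
    using online_ranking_partner_if_unmatched[OF inj_category_perm a ab] unmatched
    unfolding category_matching_def by blast
  have "(a, u) \<in> E" using u(1) M by (auto simp: is_matching_def)
  then have "u \<in> {1..m}" "b \<in> {1..m}" using ab E by force+
  then have "c u \<le> c b" using less_imp_le[OF u(2)] by (rule category_le_if_category_perm_le)
  moreover have "partner_category K c ?M a = c u"
    using M u(1) by (intro partner_category_matched) (simp_all add: is_matching_def)
  ultimately show False using less eq by simp
qed


section \<open>The gain of an edge\<close>

text \<open>Truncated subtraction gives \<open>share K t = 1\<close> for every \<open>t > K\<close>, so monotonicity and the
  bounds by 0 and 1 need no condition on \<open>t\<close>.\<close>

definition share :: "nat \<Rightarrow> nat \<Rightarrow> real" where
  "share K t = (real K / (real K + 1)) ^ (K + 1 - t)"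

lemma share_nonneg: "share K t \<ge> 0"
  by (simp add: share_def)

lemma share_le_1: "share K t \<le> 1"
  by (simp add: share_def power_le_one)

lemma share_mono: "s \<le> t \<Longrightarrow> share K s \<le> share K t"
  unfolding share_def by (rule power_decreasing) auto

lemma share_top: "share K (K + 1) = 1"
  by (simp add: share_def)

lemma share_1: "share K 1 = (real K / (real K + 1)) ^ K"
  by (simp add: share_def)

lemma share_Suc:
  assumes "t \<le> K"
  shows "K * share K (Suc t) = (real K + 1) * share K t"
proof -
  have "share K t = real K / (real K + 1) * share K (Suc t)"
    using assms by (simp add: share_def Suc_diff_le)
  also have "(real K + 1) * \<dots> = K * share K (Suc t)" by (simp add: field_simps)
  finally show ?thesis by simp
qed

lemma sum_share:
  assumes "y \<in> {1..K + 1}"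
  shows "(\<Sum>t = 1..<y. share K t) = K * (share K y - share K 1)"
proof -
  have "1 \<le> y" "y \<le> K + 1" using assms by simp_all
  then show ?thesis
  proof (induction y rule: dec_induct)
    case (step y)
    then show ?case using share_Suc[of y K] by (simp add: algebra_simps)
  qed simp
qed

lemma sum_share_threshold:
  assumes "y \<in> {1..K + 1}"
  shows "(\<Sum>x = 1..K. 1 - share K y + (if x < y then share K x else 0)) = K * (1 - share K 1)"
proof -
  have "{1..K} \<inter> {x. x < y} = {1..<y}" using assms by auto
  then have "(\<Sum>x = 1..K. if x < y then share K x else 0) = (\<Sum>x = 1..<y. share K x)"
    by (simp add: sum.If_cases)
  then show ?thesis unfolding sum.distrib sum_share[OF assms] by (simp add: algebra_simps)
qed

definition edge_gain :: "nat \<Rightarrow> (nat \<Rightarrow> nat) \<Rightarrow> (nat \<times> nat) set \<Rightarrow> nat \<times> nat \<Rightarrow> real" where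
  "edge_gain K c M e =
     1 - share K (partner_category K c M (fst e)) +
     (if snd e \<in> snd ` M then share K (c (snd e)) else 0)"

lemma sum_le_sum_if_zero_outside:
  fixes h :: "'b \<Rightarrow> real"
  assumes "finite S" "finite T" "inj_on f S" "inj_on f T"
    and "\<And>y. h y \<ge> 0" "\<And>y. y \<notin> f ` T \<Longrightarrow> h y = 0"
  shows "(\<Sum>x\<in>S. h (f x)) \<le> (\<Sum>x\<in>T. h (f x))"
proof -
  have "(\<Sum>x\<in>S. h (f x)) = sum h (f ` S)" using assms(3) by (simp add: sum.reindex)
  also have "\<dots> \<le> sum h (f ` S \<union> f ` T)" using assms(1,2,5) by (intro sum_mono2) auto
  also have "\<dots> = sum h (f ` T)"
    using assms(1,2,6) by (intro sum.mono_neutral_right) auto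
  also have "\<dots> = (\<Sum>x\<in>T. h (f x))" using assms(4) by (simp add: sum.reindex)
  finally show ?thesis .
qed

lemma sum_edge_gain_le_card:
  assumes "finite M" "inj_on fst M" "inj_on snd M" "finite M'" "inj_on fst M'" "inj_on snd M'"
  shows "(\<Sum>e\<in>M'. edge_gain K c M e) \<le> card M"
proof -
  let ?left = "\<lambda>a. 1 - share K (partner_category K c M a)"
  let ?right = "\<lambda>b. if b \<in> snd ` M then share K (c b) else 0"
  have "(\<Sum>e\<in>M'. ?left (fst e)) \<le> (\<Sum>e\<in>M. ?left (fst e))"
    using assms share_le_1 share_top
    by (intro sum_le_sum_if_zero_outside[where h = ?left])
      (simp_all add: partner_category_unmatched)
  also have "\<dots> = (\<Sum>e\<in>M. 1 - share K (c (snd e)))"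
    using assms(2) by (intro sum.cong) (auto simp: partner_category_matched)
  finally have left: "(\<Sum>e\<in>M'. ?left (fst e)) \<le> (\<Sum>e\<in>M. 1 - share K (c (snd e)))" .
  have "(\<Sum>e\<in>M'. ?right (snd e)) \<le> (\<Sum>e\<in>M. ?right (snd e))"
    using assms share_nonneg by (intro sum_le_sum_if_zero_outside[where h = ?right]) simp_all
  also have "\<dots> = (\<Sum>e\<in>M. share K (c (snd e)))" by (intro sum.cong) auto
  finally have "(\<Sum>e\<in>M'. edge_gain K c M e) \<le>
      (\<Sum>e\<in>M. 1 - share K (c (snd e))) + (\<Sum>e\<in>M. share K (c (snd e)))"
    using left unfolding edge_gain_def sum.distrib by (rule add_mono[rotated])
  then show ?thesis by (simp add: sum_subtractf)
qed

lemma edge_gain_ge_threshold: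
  fixes K m a b :: nat and c :: "nat \<Rightarrow> nat" and E :: "(nat \<times> nat) set" and as :: "nat list"
  defines "y \<equiv> partner_category K c (category_matching m c (delete_right {b} E) as) a"
  assumes E: "snd ` E \<subseteq> {1..m}" and "distinct as" and a: "a \<in> set as" and ab: "(a, b) \<in> E"
    and c: "\<And>u. u \<in> snd ` E \<Longrightarrow> c u \<in> {1..K}"
  shows "1 - share K y + (if c b < y then share K (c b) else 0)
    \<le> edge_gain K c (category_matching m c E as) (a, b)"
proof -
  let ?M = "category_matching m c E as"
  have "partner_category K c ?M a \<le> y"
    unfolding y_def using E \<open>distinct as\<close> c by (rule partner_category_le_delete_right)
  then have "share K (partner_category K c ?M a) \<le> share K y" by (rule share_mono)
  moreover have "b \<in> snd ` ?M" if "c b < y"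
    using category_matching_matches_if_less[OF E \<open>distinct as\<close> a ab] that unfolding y_def .
  ultimately show ?thesis using share_nonneg[of K "c b"] by (simp add: edge_gain_def)
qed

lemma sum_edge_gain_upd_ge:
  assumes E: "snd ` E \<subseteq> {1..m}" and "distinct as" and a: "a \<in> set as" and ab: "(a, b) \<in> E"
    and f: "\<And>u. u \<in> {1..m} - {b} \<Longrightarrow> f u \<in> {1..K}"
  shows "(\<Sum>x = 1..K. edge_gain K (f(b := x)) (category_matching m (f(b := x)) E as) (a, b))
    \<ge> K * (1 - share K 1)"
proof -
  let ?M = "\<lambda>x. category_matching m (f(b := x)) E as"
  let ?M\<^sub>0 = "category_matching m f (delete_right {b} E) as"
  define y where "y = partner_category K f ?M\<^sub>0 a"
  have "is_matching (delete_right {b} E) ?M\<^sub>0"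
    using \<open>distinct as\<close> by (rule is_matching_category_matching)
  then have inj: "inj_on fst ?M\<^sub>0" and right: "snd ` ?M\<^sub>0 \<subseteq> {1..m} - {b}"
    using E by (auto simp: is_matching_def delete_right_def)
  have y_bounds: "y \<in> {1..K + 1}"
    unfolding y_def by (rule partner_category_bounds[OF inj f[OF subsetD[OF right]]])
  have "1 - share K y + (if x < y then share K x else 0) \<le> edge_gain K (f(b := x)) (?M x) (a, b)"
    if "x \<in> {1..K}" for x
  proof -
    have in_range: "(f(b := x)) u \<in> {1..K}" if "u \<in> snd ` E" for u
      using that \<open>x \<in> {1..K}\<close> E f[of u] by auto
    show ?thesis
      using edge_gain_ge_threshold[OF E \<open>distinct as\<close> a ab, of "f(b := x)" K, OF in_range]
      unfolding partner_category_delete_right_upd[OF E \<open>distinct as\<close>] y_def fun_upd_same .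
  qed
  then have "(\<Sum>x = 1..K. 1 - share K y + (if x < y then share K x else 0))
      \<le> (\<Sum>x = 1..K. edge_gain K (f(b := x)) (?M x) (a, b))"
    by (rule sum_mono)
  then show ?thesis unfolding sum_share_threshold[OF y_bounds] .
qed


section \<open>The expected size of the matching\<close>

lemma finite_set_Pi_pmf:
  assumes "finite A" "\<And>x. x \<in> A \<Longrightarrow> finite (set_pmf (p x))"
  shows "finite (set_pmf (Pi_pmf A dflt p))"
  using assms by (auto simp: set_Pi_pmf intro: finite_PiE_dflt)

lemma expectation_Pi_pmf_insert_ge:
  fixes g :: "('a \<Rightarrow> 'b) \<Rightarrow> real"
  assumes "finite A" "b \<notin> A" and fin: "\<And>x. x \<in> insert b A \<Longrightarrow> finite (set_pmf (p x))"
    and ge: "\<And>f. f \<in> set_pmf (Pi_pmf A dflt p) \<Longrightarrow>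
      measure_pmf.expectation (p b) (\<lambda>x. g (f(b := x))) \<ge> r"
  shows "measure_pmf.expectation (Pi_pmf (insert b A) dflt p) g \<ge> r"
proof -
  let ?Q = "Pi_pmf A dflt p"
  have finQ: "finite (set_pmf ?Q)" using assms(1) fin by (intro finite_set_Pi_pmf) simp_all
  have "Pi_pmf (insert b A) dflt p = bind_pmf ?Q (\<lambda>f. map_pmf (\<lambda>x. f(b := x)) (p b))"
    unfolding Pi_pmf_insert'[OF assms(1,2)] by (subst bind_commute_pmf) (simp add: map_pmf_def)
  then have "measure_pmf.expectation (Pi_pmf (insert b A) dflt p) g =
      (\<Sum>f\<in>set_pmf ?Q. pmf ?Q f * measure_pmf.expectation (p b) (\<lambda>x. g (f(b := x))))"
    using finQ fin by (simp add: pmf_expectation_bind[where A = "set_pmf ?Q"])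
  also have "\<dots> \<ge> (\<Sum>f\<in>set_pmf ?Q. pmf ?Q f * r)"
    using ge by (intro sum_mono mult_left_mono) simp_all
  also have "(\<Sum>f\<in>set_pmf ?Q. pmf ?Q f * r) = r"
    using finQ by (simp add: sum_distrib_right[symmetric] sum_pmf_eq_1)
  finally show ?thesis .
qed

lemma expectation_edge_gain_ge:
  assumes K: "K > 0" and E: "snd ` E \<subseteq> {1..m}" and "distinct as"
    and a: "a \<in> set as" and ab: "(a, b) \<in> E"
  shows "measure_pmf.expectation (Pi_pmf {1..m} 0 (\<lambda>_. pmf_of_set {1..K}))
      (\<lambda>c. edge_gain K c (category_matching m c E as) (a, b)) \<ge> 1 - share K 1"
    (is "measure_pmf.expectation _ ?gain \<ge> _")
proof -
  let ?B = "{1..m} - {b}" and ?U = "pmf_of_set {1..K}"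
  have "measure_pmf.expectation ?U (\<lambda>x. ?gain (f(b := x))) \<ge> 1 - share K 1"
    if "f \<in> set_pmf (Pi_pmf ?B 0 (\<lambda>_. ?U))" for f
  proof -
    have "f u \<in> {1..K}" if "u \<in> ?B" for u
      using \<open>f \<in> _\<close> that K by (auto simp: set_Pi_pmf PiE_dflt_def)
    then have "K * (1 - share K 1) \<le> (\<Sum>x = 1..K. ?gain (f(b := x)))"
      using E \<open>distinct as\<close> a ab by (intro sum_edge_gain_upd_ge)
    then show ?thesis using K by (simp add: integral_pmf_of_set field_simps)
  qed
  then have "measure_pmf.expectation (Pi_pmf (insert b ?B) 0 (\<lambda>_. ?U)) ?gain \<ge> 1 - share K 1"
    using K by (intro expectation_Pi_pmf_insert_ge) simp_all
  moreover have "b \<in> {1..m}" using ab E by force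
  ultimately show ?thesis by (simp add: insert_absorb)
qed

lemma finite_if_is_matching: "is_matching E M \<Longrightarrow> finite (snd ` E) \<Longrightarrow> finite M"
  unfolding is_matching_def by (meson finite_imageD finite_subset image_mono)

lemma expectation_card_category_matching_ge:
  assumes K: "K > 0" and E: "snd ` E \<subseteq> {1..m}" "fst ` E \<subseteq> set as" and "distinct as"
    and M': "is_matching E M'"
  shows "measure_pmf.expectation (Pi_pmf {1..m} 0 (\<lambda>_. pmf_of_set {1..K}))
      (\<lambda>c. real (card (category_matching m c E as))) \<ge> (1 - share K 1) * card M'"
proof -
  let ?P = "Pi_pmf {1..m} 0 (\<lambda>_. pmf_of_set {1..K})"
  let ?M = "\<lambda>c. category_matching m c E as"
  have integrable: "integrable (measure_pmf ?P) g" for g :: "_ \<Rightarrow> real"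
    using K by (intro integrable_measure_pmf_finite finite_set_Pi_pmf) simp_all
  have fin: "finite (snd ` E)" using E(1) by (rule finite_subset) simp
  have "(1 - share K 1) * card M' = (\<Sum>e\<in>M'. 1 - share K 1)" by simp
  also have "\<dots> \<le> (\<Sum>e\<in>M'. measure_pmf.expectation ?P (\<lambda>c. edge_gain K c (?M c) e))"
  proof (rule sum_mono)
    fix e assume "e \<in> M'"
    then have "(fst e, snd e) \<in> E" "fst e \<in> set as" using M' E(2) by (auto simp: is_matching_def)
    then show "1 - share K 1 \<le> measure_pmf.expectation ?P (\<lambda>c. edge_gain K c (?M c) e)"
      using expectation_edge_gain_ge[OF K E(1) \<open>distinct as\<close>, of "fst e" "snd e"] by simp
  qed
  also have "\<dots> = measure_pmf.expectation ?P (\<lambda>c. \<Sum>e\<in>M'. edge_gain K c (?M c) e)"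
    using integrable by (simp add: Bochner_Integration.integral_sum)
  also have "\<dots> \<le> measure_pmf.expectation ?P (\<lambda>c. real (card (?M c)))"
  proof (rule integral_mono[OF integrable integrable])
    fix c
    have M: "is_matching E (?M c)" using \<open>distinct as\<close> by (rule is_matching_category_matching)
    show "(\<Sum>e\<in>M'. edge_gain K c (?M c) e) \<le> real (card (?M c))"
      using M M' finite_if_is_matching[OF M fin] finite_if_is_matching[OF M' fin]
      by (intro sum_edge_gain_le_card) (simp_all add: is_matching_def)
  qed
  finally show ?thesis .
qed

theorem theorem17:
  fixes k :: nat
  assumes "k \<ge> 1"
  shows "(\<forall>m. coin_pmf (random_categories k m) =
              Pi_pmf {1..m} 0 (\<lambda>_. pmf_of_set {1..2 ^ k}))
    \<and> (\<forall>m. uses_random_bits (category_ranking k m) (k * m))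
    \<and> legal_algorithm (category_ranking k)
    \<and> has_competitive_ratio (category_ranking k) (1 - (2 ^ k / (2 ^ k + 1)) ^ (2 ^ k))"
proof (intro conjI allI)
  show "legal_algorithm (category_ranking k)"
    by (auto simp: legal_algorithm_def coin_pmf_category_ranking legal_rule_ranking)
  have ratio: "(2 ^ k / (2 ^ k + 1)) ^ (2 ^ k) = share (2 ^ k) 1"
    unfolding share_1 by simp
  show "has_competitive_ratio (category_ranking k) (1 - (2 ^ k / (2 ^ k + 1)) ^ (2 ^ k))"
    unfolding has_competitive_ratio_def coin_pmf_category_ranking integral_map_pmf ratio
      category_matching_def[symmetric]
  proof (intro allI impI)
    fix n m E arrivals Mstar
    assume "E \<subseteq> {1..n} \<times> {1..m}" "distinct arrivals" "set arrivals = {1..n}"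
      and "is_maximum_matching E Mstar"
    then show "(1 - share (2 ^ k) 1) * real (card Mstar)
      \<le> measure_pmf.expectation (Pi_pmf {1..m} 0 (\<lambda>_. pmf_of_set {1..2 ^ k}))
          (\<lambda>c. real (card (category_matching m c E arrivals)))"
      by (intro expectation_card_category_matching_ge) (auto simp: is_maximum_matching_def)
  qed
qed (fact coin_pmf_random_categories uses_random_bits_category_ranking)+

end
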